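(* Let $n\ge 3$, let $x_1,\dots,x_n$ be variables on a ring (indices modulo $n$) each with $q$ possible states, and let $p_c$ be a probability distribution on the ring which is factorized with the help of a belief propagation fixed point as $$p_c(x_1,\dots,x_n)=\frac1{Z_{\rm BP}}\prod_{i=1}^n\frac{b_i^c(x_i,x_{i+1})}{b_i^c(x_i)},$$ where $b_i^c(x_i)$ and $b_i^c(x_i,x_{i+1})$ are the single-variable and pairwise beliefs. Define the $q\times q$ matrices $$B^{(i)}_{xy}=\frac{b_i^c(x,y)-b_i^c(x)\,b_{i+1}^c(y)}{b_i^c(x)},$$ and $$U=\prod_{i=1}^nB^{(i)},\qquad U^{(i)}=\prod_{j=i}^nB^{(j)}\prod_{j=1}^{i-1}B^{(j)},\qquad V^{(i)}=\prod_{j=i+1}^nB^{(j)}\prod_{j=1}^{i-1}B^{(j)}$$ (matrix products ordered by increasing index from left to right). Then $Z_{\rm BP}=1+\operatorname{Tr}(U)$, and the exact marginals $p_i^c(x)$ of $x_i$ and $p_i^c(x,y)$ of $(x_i,x_{i+1})$ under $p_c$ are $$p_i^c(x)=\frac{b_i^c(x)+U^{(i)}_{xx}}{Z_{\rm BP}},\qquad p_i^c(x,y)=\frac{b_i^c(x,y)+V^{(i)}_{yx}\,b_{i+1}^c(y)+B^{(i)}_{xy}V^{(i)}_{yx}}{Z_{\rm BP}}.$$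
   Context: The beliefs at a belief propagation fixed point are positive probability distributions that are locally consistent: $\sum_yb_i^c(x,y)=b_i^c(x)$ and $\sum_xb_i^c(x,y)=b_{i+1}^c(y)$ for all $i$ (indices modulo $n$). $Z_{\rm BP}$ is the normalization constant. Empty matrix products are the identity. *)

theory Defs
  imports "HOL-Probability.Probability"
begin

text \<open>
  Sites of the ring are the naturals \<open>1, \<dots>, n\<close>; the \<open>q\<close> states are the elements of a
  finite type \<open>'q\<close>.  A belief family is a pair \<open>b1\<close>, \<open>b2\<close>, where \<open>b2 i\<close> belongs to
  the edge from site \<open>i\<close> to its successor.
\<close>

definition ring_succ :: "nat \<Rightarrow> nat \<Rightarrow> nat" where
  "ring_succ n i = i mod n + 1"

definition configs :: "nat \<Rightarrow> (nat \<Rightarrow> 'q) set" where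
  "configs n = {1..n} \<rightarrow>\<^sub>E UNIV"

text \<open>
  The properties of the beliefs at a belief propagation fixed point: positive probability
  distributions that are locally consistent.
\<close>

definition bp_beliefs ::
    "nat \<Rightarrow> (nat \<Rightarrow> 'q::finite \<Rightarrow> real) \<Rightarrow> (nat \<Rightarrow> 'q \<Rightarrow> 'q \<Rightarrow> real) \<Rightarrow> bool" where
  "bp_beliefs n b1 b2 \<longleftrightarrow> (\<forall>i\<in>{1..n}.
     (\<forall>x. b1 i x > 0) \<and> (\<Sum>x\<in>UNIV. b1 i x) = 1 \<and>
     (\<forall>x y. b2 i x y > 0) \<and> (\<Sum>x\<in>UNIV. \<Sum>y\<in>UNIV. b2 i x y) = 1 \<and>
     (\<forall>x. (\<Sum>y\<in>UNIV. b2 i x y) = b1 i x) \<and>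
     (\<forall>y. (\<Sum>x\<in>UNIV. b2 i x y) = b1 (ring_succ n i) y))"

definition ring_weight ::
    "nat \<Rightarrow> (nat \<Rightarrow> 'q \<Rightarrow> real) \<Rightarrow> (nat \<Rightarrow> 'q \<Rightarrow> 'q \<Rightarrow> real) \<Rightarrow> (nat \<Rightarrow> 'q) \<Rightarrow> real" where
  "ring_weight n b1 b2 s = (\<Prod>i=1..n. b2 i (s i) (s (ring_succ n i)) / b1 i (s i))"

definition Z_BP ::
    "nat \<Rightarrow> (nat \<Rightarrow> 'q::finite \<Rightarrow> real) \<Rightarrow> (nat \<Rightarrow> 'q \<Rightarrow> 'q \<Rightarrow> real) \<Rightarrow> real" where
  "Z_BP n b1 b2 = (\<Sum>s\<in>configs n. ring_weight n b1 b2 s)"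

definition B_mat ::
    "nat \<Rightarrow> (nat \<Rightarrow> 'q::finite \<Rightarrow> real) \<Rightarrow> (nat \<Rightarrow> 'q \<Rightarrow> 'q \<Rightarrow> real) \<Rightarrow> nat \<Rightarrow> real^'q^'q" where
  "B_mat n b1 b2 i = (\<chi> x y. (b2 i x y - b1 i x * b1 (ring_succ n i) y) / b1 i x)"

text \<open>
  \<open>mat_prod M i j\<close> is \<open>M i ** M (i + 1) ** \<dots> ** M j\<close>, the identity if \<open>j < i\<close>.  (The
  library's \<open>prod_list\<close> is not usable: \<open>*\<close> on \<open>real^'q^'q\<close> is componentwise.)
\<close>

definition mat_prod :: "(nat \<Rightarrow> real^'q^'q) \<Rightarrow> nat \<Rightarrow> nat \<Rightarrow> real^'q::finite^'q" where
  "mat_prod M i j = foldr (\<lambda>k P. M k ** P) [i..<Suc j] (mat 1)"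

definition U_tot ::
    "nat \<Rightarrow> (nat \<Rightarrow> 'q::finite \<Rightarrow> real) \<Rightarrow> (nat \<Rightarrow> 'q \<Rightarrow> 'q \<Rightarrow> real) \<Rightarrow> real^'q^'q" where
  "U_tot n b1 b2 = mat_prod (B_mat n b1 b2) 1 n"

definition U_mat ::
    "nat \<Rightarrow> (nat \<Rightarrow> 'q::finite \<Rightarrow> real) \<Rightarrow> (nat \<Rightarrow> 'q \<Rightarrow> 'q \<Rightarrow> real) \<Rightarrow> nat \<Rightarrow> real^'q^'q" where
  "U_mat n b1 b2 i = mat_prod (B_mat n b1 b2) i n ** mat_prod (B_mat n b1 b2) 1 (i - 1)"

definition V_mat ::
    "nat \<Rightarrow> (nat \<Rightarrow> 'q::finite \<Rightarrow> real) \<Rightarrow> (nat \<Rightarrow> 'q \<Rightarrow> 'q \<Rightarrow> real) \<Rightarrow> nat \<Rightarrow> real^'q^'q" where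
  "V_mat n b1 b2 i = mat_prod (B_mat n b1 b2) (i + 1) n ** mat_prod (B_mat n b1 b2) 1 (i - 1)"

end

theory Submission
  imports Defs
begin

text \<open>
  Let \<open>A\<^sub>i\<close> be the transition matrix \<open>b\<^sub>i(x, y) / b\<^sub>i(x)\<close>, so that \<open>p\<^sub>c\<close> is a product of entries
  of the \<open>A\<^sub>i\<close> and all sums over configurations are traces of products of the \<open>A\<^sub>i\<close>.  With the
  all-ones column \<open>1\<close> one has \<open>A\<^sub>i = B\<^sub>i + 1 b\<^sub>i\<^sub>+\<^sub>1\<^sup>T\<close>, where local consistency says exactly that
  \<open>B\<^sub>i 1 = 0\<close> and \<open>b\<^sub>i\<^sup>T B\<^sub>i = 0\<close>.  Hence all cross terms vanish in a product of consecutive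
  factors: \<open>A\<^sub>i \<cdots> A\<^sub>j = B\<^sub>i \<cdots> B\<^sub>j + 1 b\<^sub>j\<^sub>+\<^sub>1\<^sup>T\<close>.
\<close>

section \<open>Ordered products of matrices\<close>

lemma mat_prod_empty [simp]: "j < i \<Longrightarrow> mat_prod M i j = mat 1"
  by (simp add: mat_prod_def)

lemma mat_prod_rec: "i \<le> j \<Longrightarrow> mat_prod M i j = M i ** mat_prod M (Suc i) j"
  by (simp add: mat_prod_def upt_conv_Cons del: upt_Suc)

lemma mat_prod_single [simp]: "mat_prod M i i = M i"
  by (simp add: mat_prod_def)

text \<open>The seed \<open>X\<close> comes out as a right factor by associativity, so concatenating
  index lists multiplies the products.\<close>

lemma foldr_matrix_mul:
  "foldr (\<lambda>k P. M k ** P) ks X = foldr (\<lambda>k P. M k ** P) ks (mat 1) ** X"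
  for X :: "real^'q::finite^'q"
  by (induction ks) (simp_all flip: matrix_mul_assoc)

lemma mat_prod_append:
  assumes "i \<le> Suc j" "j \<le> k"
  shows "mat_prod M i k = mat_prod M i j ** mat_prod M (Suc j) k"
proof -
  have "[i..<Suc k] = [i..<Suc j] @ [Suc j..<Suc k]"
    using assms upt_add_eq_append[of i "Suc j" "k - j"] by simp
  then show ?thesis
    unfolding mat_prod_def by (metis foldr_append foldr_matrix_mul)
qed

lemma mat_prod_Suc: "i \<le> Suc j \<Longrightarrow> mat_prod M i (Suc j) = mat_prod M i j ** M (Suc j)"
  by (simp add: mat_prod_append[of i j "Suc j"])

lemma mat_prod_split3:
  assumes "i \<in> {1..n}"
  shows "mat_prod M 1 n = mat_prod M 1 (i - 1) ** M i ** mat_prod M (i + 1) n"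
proof -
  have "mat_prod M 1 n = mat_prod M 1 (i - 1) ** mat_prod M i n"
    using assms mat_prod_append[of 1 "i - 1" n M] by fastforce
  then show ?thesis
    using assms by (simp add: mat_prod_rec[of i n] matrix_mul_assoc)
qed

lemma mat_prod_cong: "(\<And>k. k \<in> {i..j} \<Longrightarrow> M k = N k) \<Longrightarrow> mat_prod M i j = mat_prod N i j"
  unfolding mat_prod_def by (intro foldr_cong) auto

section \<open>Sums over configurations as matrix products and traces\<close>

lemma sum_PiE_insert:
  fixes F :: "('a \<Rightarrow> 'q::finite) \<Rightarrow> 'b::comm_monoid_add"
  assumes "a \<notin> I"
  shows "(\<Sum>s\<in>insert a I \<rightarrow>\<^sub>E UNIV. F s) = (\<Sum>s\<in>I \<rightarrow>\<^sub>E UNIV. \<Sum>y\<in>UNIV. F (s(a := y)))"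
proof -
  have "(\<Sum>s\<in>insert a I \<rightarrow>\<^sub>E UNIV. F s) =
      (\<Sum>(y, s)\<in>UNIV \<times> (I \<rightarrow>\<^sub>E UNIV). F (s(a := y)))"
    using inj_combinator[OF assms, of "\<lambda>_. UNIV :: 'q set"]
    by (simp add: PiE_insert_eq sum.reindex case_prod_unfold)
  then show ?thesis
    unfolding sum.cartesian_product[symmetric] by (subst sum.swap)
qed

text \<open>Each induction step sums out the last site. Its factor is absorbed into the end-point
  weight, which is why \<open>f\<close> must be arbitrary.\<close>

lemma path_sum_eq_mat_prod:
  fixes M :: "nat \<Rightarrow> real^'q::finite^'q"
  shows "(\<Sum>s\<in>{1..Suc m} \<rightarrow>\<^sub>E UNIV. f (s 1) (s (Suc m)) * (\<Prod>i=1..m. M i $ s i $ s (Suc i))) =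
    (\<Sum>x\<in>UNIV. \<Sum>y\<in>UNIV. f x y * mat_prod M 1 m $ x $ y)"
proof (induction m arbitrary: f)
  case 0
  \<comment> \<open>With a single site both ends coincide; on the right the empty product
    \<open>mat 1\<close> enforces this.\<close>
  show ?case
    using sum_PiE_insert[of "1::nat" "{}" "\<lambda>s. f (s 1) (s (1::nat))"]
    by (simp add: mat_def if_distrib cong: if_cong)
next
  case (Suc m)
  have I: "{1..Suc (Suc m)} = insert (Suc (Suc m)) {1..Suc m}"
    by auto
  have "(\<Sum>s\<in>{1..Suc (Suc m)} \<rightarrow>\<^sub>E UNIV.
          f (s 1) (s (Suc (Suc m))) * (\<Prod>i=1..Suc m. M i $ s i $ s (Suc i))) =
        (\<Sum>s\<in>{1..Suc m} \<rightarrow>\<^sub>E UNIV. (\<Sum>y\<in>UNIV. f (s 1) y * M (Suc m) $ s (Suc m) $ y) *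
          (\<Prod>i=1..m. M i $ s i $ s (Suc i)))"
    unfolding I
    by (subst sum_PiE_insert) (auto simp: sum_distrib_right sum_distrib_left mult_ac intro!: sum.cong prod.cong)
  also have "\<dots> = (\<Sum>x\<in>UNIV. \<Sum>z\<in>UNIV. (\<Sum>y\<in>UNIV. f x y * M (Suc m) $ z $ y) *
          mat_prod M 1 m $ x $ z)"
    by (rule Suc.IH)
  also have "\<dots> = (\<Sum>x\<in>UNIV. \<Sum>y\<in>UNIV. f x y * mat_prod M 1 (Suc m) $ x $ y)"
    by (simp add: mat_prod_Suc matrix_matrix_mult_def sum_distrib_left sum_distrib_right mult_ac)
      (rule sum.cong[OF refl], rule sum.swap)
  finally show ?case .
qed

text \<open>Cutting the ring between sites \<open>n\<close> and \<open>1\<close> leaves an open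
  path; \<open>M n\<close>, from the last site to the first, is its end-point weight.\<close>

lemma ring_sum_eq_trace:
  fixes M :: "nat \<Rightarrow> real^'q::finite^'q"
  assumes "n \<ge> 1"
  shows "(\<Sum>s\<in>configs n. \<Prod>i=1..n. M i $ s i $ s (ring_succ n i)) = trace (mat_prod M 1 n)"
proof -
  obtain m where n: "n = Suc m"
    using assms by (cases n) auto
  have "(\<Prod>i=1..n. M i $ s i $ s (ring_succ n i)) =
      M n $ s n $ s 1 * (\<Prod>i=1..m. M i $ s i $ s (Suc i))" for s
    by (auto simp: n ring_succ_def mult.commute intro!: prod.cong)
  then have "(\<Sum>s\<in>configs n. \<Prod>i=1..n. M i $ s i $ s (ring_succ n i)) =
      (\<Sum>x\<in>UNIV. \<Sum>y\<in>UNIV. M n $ y $ x * mat_prod M 1 m $ x $ y)"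
    using path_sum_eq_mat_prod[of "\<lambda>x y. M n $ y $ x" m M] by (simp add: configs_def n)
  then show ?thesis
    by (simp add: n mat_prod_Suc trace_def matrix_matrix_mult_def mult.commute)
qed

text \<open>Only one summand of the trace survives. This is the source of the transposed index in
  the pair marginals.\<close>

lemma trace_mul_single_entry:
  fixes X :: "real^'q::finite^'q"
  shows "trace ((\<chi> x' y'. if x' = x \<and> y' = y then a else 0) ** X) = a * X $ y $ x"
proof -
  have "trace ((\<chi> x' y'. if x' = x \<and> y' = y then a else 0) ** X) =
      (\<Sum>x'\<in>UNIV. \<Sum>y'\<in>UNIV. (if x' = x \<and> y' = y then a else 0) * X $ y' $ x')"
    by (simp add: trace_def matrix_matrix_mult_def)
  also have "\<dots> = (\<Sum>x'\<in>UNIV. if x' = x then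
      \<Sum>y'\<in>UNIV. if y' = y then a * X $ y $ x else 0 else 0)"
    by (rule sum.cong[OF refl]) (simp add: if_distrib[of "\<lambda>c. c * _"] cong: if_cong)
  finally show ?thesis
    by simp
qed

text \<open>
  The edge condition is imposed by replacing the matrix at position \<open>i\<close> by its single
  entry \<open>(x, y)\<close>.
\<close>

lemma ring_sum_edge:
  fixes M :: "nat \<Rightarrow> real^'q::finite^'q"
  assumes i: "i \<in> {1..n}"
  shows "(\<Sum>s\<in>configs n. if s i = x \<and> s (ring_succ n i) = y
           then \<Prod>k=1..n. M k $ s k $ s (ring_succ n k) else 0) =
    M i $ x $ y * (mat_prod M (i + 1) n ** mat_prod M 1 (i - 1)) $ y $ x"
proof -
  define D where "D = (\<chi> x' y'. if x' = x \<and> y' = y then M i $ x $ y else 0)"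
  define N where "N = M(i := D)"
  have "(if s i = x \<and> s (ring_succ n i) = y
           then \<Prod>k=1..n. M k $ s k $ s (ring_succ n k) else 0) =
        (\<Prod>k=1..n. N k $ s k $ s (ring_succ n k))" for s
    using i by (auto simp: N_def D_def prod.remove[of _ i] intro!: prod.cong)
  then have "(\<Sum>s\<in>configs n. if s i = x \<and> s (ring_succ n i) = y
           then \<Prod>k=1..n. M k $ s k $ s (ring_succ n k) else 0) = trace (mat_prod N 1 n)"
    using i by (simp add: ring_sum_eq_trace del: One_nat_def)
  also have "\<dots> = trace (mat_prod N 1 (i - 1) ** D ** mat_prod N (i + 1) n)"
    unfolding mat_prod_split3[OF i] by (simp add: N_def)
  also have "\<dots> = trace (mat_prod M 1 (i - 1) ** (D ** mat_prod M (i + 1) n))"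
  proof -
    have "mat_prod N 1 (i - 1) = mat_prod M 1 (i - 1)"
      using i by (intro mat_prod_cong) (auto simp: N_def)
    moreover have "mat_prod N (i + 1) n = mat_prod M (i + 1) n"
      by (intro mat_prod_cong) (auto simp: N_def)
    ultimately show ?thesis
      by (simp add: matrix_mul_assoc)
  qed
  \<comment> \<open>Cyclicity of the trace puts the tail before the head, the order of the factors
    in \<open>V_mat\<close>.\<close>
  also have "\<dots> = trace (D ** (mat_prod M (i + 1) n ** mat_prod M 1 (i - 1)))"
    by (subst trace_mul_sym) (simp add: matrix_mul_assoc)
  finally show ?thesis
    by (simp add: D_def trace_mul_single_entry)
qed

section \<open>Splitting off a rank-one part\<close>

definition const_rows :: "real^'q \<Rightarrow> real^'q^'q" where
  "const_rows v = (\<chi> x. v)"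

text \<open>\<open>const_rows w\<close> is the outer product \<open>1 w^T\<close>, so
  \<open>Q\<close> acts on the column \<open>1\<close> only.\<close>

lemma matrix_mul_const_rows: "Q ** const_rows w = (\<chi> x y. (Q *v 1) $ x * w $ y)"
  for Q :: "real^'q::finite^'q"
  by (simp add: vec_eq_iff const_rows_def matrix_matrix_mult_def matrix_vector_mult_def
      sum_distrib_right)

lemma const_rows_matrix_mul: "const_rows v ** Q = const_rows (v v* Q)"
  for Q :: "real^'q::finite^'q"
  by (simp add: vec_eq_iff const_rows_def matrix_matrix_mult_def vector_matrix_mult_def mult.commute)

lemma matrix_mul_add_left: "(P + Q) ** R = P ** R + Q ** R"
  for P Q R :: "real^'q::finite^'q"
  by (simp add: vec_eq_iff matrix_matrix_mult_def distrib_right sum.distrib)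

text \<open>
  \<open>P = Q + 1 v\<^sup>T\<close> with \<open>Q 1 = 0\<close> and \<open>u\<^sup>T Q = 0\<close>: if the entries of \<open>u\<close> also sum
  to \<open>1\<close>, then \<open>P 1 = 1\<close> and \<open>u\<^sup>T P = v\<^sup>T\<close>.
\<close>

definition transition_split ::
    "real^'q \<Rightarrow> real^'q \<Rightarrow> real^'q^'q \<Rightarrow> real^'q::finite^'q \<Rightarrow> bool" where
  "transition_split u v P Q \<longleftrightarrow>
     P = Q + const_rows v \<and> Q *v 1 = 0 \<and> u v* Q = 0 \<and> sum (($) v) UNIV = 1"

text \<open>In \<open>(Q + 1 v^T) (Q' + 1 w^T)\<close> the cross terms vanish by
  \<open>Q 1 = 0\<close> and \<open>v^T Q' = 0\<close>, and \<open>v^T 1 = 1\<close> reduces the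
  last term to \<open>1 w^T\<close>.\<close>

lemma transition_split_mul:
  assumes "transition_split u v P Q" "transition_split v w P' Q'"
  shows "transition_split u w (P ** P') (Q ** Q')"
proof -
  have 1: "Q ** const_rows w = 0"
    using assms(1) by (simp add: transition_split_def matrix_mul_const_rows vec_eq_iff)
  have 2: "const_rows v ** Q' = 0"
    using assms(2) by (simp add: transition_split_def const_rows_matrix_mul)
      (simp add: const_rows_def vec_eq_iff)
  have 3: "const_rows v ** const_rows w = const_rows w"
    using assms(1) by (simp add: transition_split_def matrix_mul_const_rows)
      (simp add: const_rows_def vec_eq_iff matrix_vector_mult_def)
  have "P ** P' = (Q + const_rows v) ** (Q' + const_rows w)"
    using assms by (simp add: transition_split_def)
  also have "\<dots> = Q ** Q' + const_rows w"
    by (simp add: matrix_add_ldistrib matrix_mul_add_left 1 2 3)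
  finally have "P ** P' = Q ** Q' + const_rows w" .
  moreover have "(Q ** Q') *v 1 = 0"
    using assms(2) by (simp add: transition_split_def flip: matrix_vector_mul_assoc)
  moreover have "u v* (Q ** Q') = 0"
    using assms(1) by (simp add: transition_split_def flip: vector_matrix_mul_assoc)
  ultimately show ?thesis
    using assms(2) by (simp add: transition_split_def)
qed

section \<open>Splitting the transition matrices of the beliefs\<close>

definition b_vec :: "(nat \<Rightarrow> 'q \<Rightarrow> real) \<Rightarrow> nat \<Rightarrow> real^'q" where
  "b_vec b1 i = (\<chi> x. b1 i x)"

definition A_mat :: "(nat \<Rightarrow> 'q \<Rightarrow> real) \<Rightarrow> (nat \<Rightarrow> 'q \<Rightarrow> 'q \<Rightarrow> real) \<Rightarrow> nat \<Rightarrow> real^'q^'q" where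
  "A_mat b1 b2 i = (\<chi> x y. b2 i x y / b1 i x)"

lemma ring_weight_eq:
  "ring_weight n b1 b2 s = (\<Prod>i=1..n. A_mat b1 b2 i $ s i $ s (ring_succ n i))"
  by (simp add: ring_weight_def A_mat_def)

lemma bp_beliefsD:
  assumes "bp_beliefs n b1 b2" "i \<in> {1..n}"
  shows "b1 i x > 0" "(\<Sum>x\<in>UNIV. b1 i x) = 1" "(\<Sum>y\<in>UNIV. b2 i x y) = b1 i x"
    "(\<Sum>x\<in>UNIV. b2 i x y) = b1 (ring_succ n i) y"
  using assms unfolding bp_beliefs_def by blast+

lemma ring_succ_in: "i \<in> {1..n} \<Longrightarrow> ring_succ n i \<in> {1..n}"
  by (simp add: ring_succ_def Suc_le_eq)

text \<open>Row sums of \<open>B_mat\<close> vanish by the first marginal of \<open>b2\<close> and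
  normalization. Weighting the rows by \<open>b1 i\<close> cancels the denominators, and the column
  sums then vanish by the second marginal.\<close>

lemma transition_split_single:
  assumes b: "bp_beliefs n b1 b2" and i: "i \<in> {1..n}"
  shows "transition_split (b_vec b1 i) (b_vec b1 (ring_succ n i)) (A_mat b1 b2 i) (B_mat n b1 b2 i)"
proof -
  note bi = bp_beliefsD[OF b i]
  note bs = bp_beliefsD[OF b ring_succ_in[OF i]]
  have nz: "b1 i x \<noteq> 0" for x
    using bi(1)[of x] by simp
  have "A_mat b1 b2 i = B_mat n b1 b2 i + const_rows (b_vec b1 (ring_succ n i))"
    by (simp add: vec_eq_iff A_mat_def B_mat_def const_rows_def b_vec_def nz field_simps)
  moreover have "B_mat n b1 b2 i *v 1 = 0"
    by (simp add: vec_eq_iff B_mat_def matrix_vector_mult_def bi bs sum_subtractf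
        flip: sum_divide_distrib sum_distrib_left)
  moreover have "b_vec b1 i v* B_mat n b1 b2 i = 0"
    by (simp add: vec_eq_iff B_mat_def b_vec_def vector_matrix_mult_def nz bi sum_subtractf
        flip: sum_distrib_right)
  ultimately show ?thesis
    by (simp add: transition_split_def b_vec_def bs)
qed

text \<open>Single splittings are chained. The induction starts at \<open>j = i\<close> because the
  empty product does not split.\<close>

lemma transition_split_mat_prod:
  assumes b: "bp_beliefs n b1 b2" and "1 \<le> i" "i \<le> j" "j \<le> n"
  shows "transition_split (b_vec b1 i) (b_vec b1 (ring_succ n j))
    (mat_prod (A_mat b1 b2) i j) (mat_prod (B_mat n b1 b2) i j)"
  using assms(3,4)
proof (induction j rule: dec_induct)
  case base
  then show ?case
    using transition_split_single[OF b] assms(2) by simp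
next
  case (step j)
  \<comment> \<open>Here \<open>j < n\<close>, so the successor does not wrap around.\<close>
  have "ring_succ n j = Suc j"
    using step by (simp add: ring_succ_def)
  then show ?case
    using step assms(2) transition_split_mul transition_split_single[OF b, of "Suc j"]
    by (force simp: mat_prod_Suc)
qed

text \<open>
  With \<open>n \<ge> 2\<close> at least one of the two factors is a nonempty product; for \<open>n = 1\<close> both
  the \<open>A\<close>-product and \<open>V\<close> are the identity, which does not split.
\<close>

lemma transition_split_V_mat:
  assumes b: "bp_beliefs n b1 b2" and n: "n \<ge> 2" and i: "i \<in> {1..n}"
  shows "transition_split (b_vec b1 (ring_succ n i)) (b_vec b1 i)
    (mat_prod (A_mat b1 b2) (i + 1) n ** mat_prod (A_mat b1 b2) 1 (i - 1)) (V_mat n b1 b2 i)"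
proof -
  have succ_n: "ring_succ n n = 1"
    by (simp add: ring_succ_def)
  have left: "transition_split (b_vec b1 (ring_succ n i)) (b_vec b1 1)
      (mat_prod (A_mat b1 b2) (i + 1) n) (mat_prod (B_mat n b1 b2) (i + 1) n)" if "i < n"
    using transition_split_mat_prod[OF b, of "i + 1" n] that succ_n
    by (simp add: ring_succ_def)
  have right: "transition_split (b_vec b1 1) (b_vec b1 i)
      (mat_prod (A_mat b1 b2) 1 (i - 1)) (mat_prod (B_mat n b1 b2) 1 (i - 1))" if "1 < i"
    using transition_split_mat_prod[OF b, of 1 "i - 1"] that i
    by (simp add: ring_succ_def)
  \<comment> \<open>At either end of the range one product is empty and drops out; in between, the
    two splittings are joined at \<open>b_vec b1 1\<close>.\<close>
  consider "i = n" "1 < i" | "i = 1" "i < n" | "1 < i" "i < n"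
    using i n by force
  then show ?thesis
  proof cases
    case 1
    then show ?thesis
      using right succ_n by (simp add: V_mat_def)
  next
    case 2
    then show ?thesis
      using left by (simp add: V_mat_def)
  next
    case 3
    then show ?thesis
      using transition_split_mul[OF left right] by (simp add: V_mat_def)
  qed
qed

section \<open>The normalization constant and the marginal weights\<close>

lemma Z_BP_eq:
  assumes b: "bp_beliefs n b1 b2" and n: "n \<ge> 1"
  shows "Z_BP n b1 b2 = 1 + trace (U_tot n b1 b2)"
proof -
  have "transition_split (b_vec b1 1) (b_vec b1 1) (mat_prod (A_mat b1 b2) 1 n) (U_tot n b1 b2)"
    using transition_split_mat_prod[OF b, of 1 n] n by (simp add: ring_succ_def U_tot_def)
  \<comment> \<open>The rank-one part contributes the sum of the entries of
    \<open>b_vec b1 1\<close>, which is 1.\<close>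
  then have "trace (mat_prod (A_mat b1 b2) 1 n) = 1 + trace (U_tot n b1 b2)"
    by (auto simp: transition_split_def trace_def const_rows_def sum.distrib)
  then show ?thesis
    using n by (simp add: Z_BP_def ring_weight_eq ring_sum_eq_trace del: One_nat_def)
qed

lemma pair_weight_sum:
  assumes b: "bp_beliefs n b1 b2" and n: "n \<ge> 2" and i: "i \<in> {1..n}"
  shows "(\<Sum>s\<in>configs n. if s i = x \<and> s (ring_succ n i) = y then ring_weight n b1 b2 s else 0) =
    b2 i x y + V_mat n b1 b2 i $ y $ x * b1 (ring_succ n i) y
      + B_mat n b1 b2 i $ x $ y * V_mat n b1 b2 i $ y $ x"
proof -
  let ?A = "A_mat b1 b2" and ?V = "V_mat n b1 b2 i"
  have "b1 i x \<noteq> 0"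
    using bp_beliefsD(1)[OF b i, of x] by simp
  then have AV: "?A i $ x $ y * b1 i x = b2 i x y"
    by (simp add: A_mat_def)
  have A: "?A i $ x $ y = B_mat n b1 b2 i $ x $ y + b1 (ring_succ n i) y"
    using transition_split_single[OF b i]
    by (simp add: transition_split_def const_rows_def b_vec_def)
  have V: "(mat_prod ?A (i + 1) n ** mat_prod ?A 1 (i - 1)) $ y $ x = ?V $ y $ x + b1 i x"
    using transition_split_V_mat[OF b n i]
    by (simp add: transition_split_def const_rows_def b_vec_def)
  \<comment> \<open>The factor \<open>?A\<close> is replaced by its splitting only where it
    multiplies \<open>?V\<close>; the other term is already \<open>b2 i x y\<close>.\<close>
  have "?A i $ x $ y * (?V $ y $ x + b1 i x) = b2 i x y + ?A i $ x $ y * ?V $ y $ x"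
    by (simp add: distrib_left AV)
  also have "\<dots> = b2 i x y + ?V $ y $ x * b1 (ring_succ n i) y
      + B_mat n b1 b2 i $ x $ y * ?V $ y $ x"
    by (simp add: A algebra_simps)
  finally show ?thesis
    unfolding ring_weight_eq ring_sum_edge[OF i] V .
qed

text \<open>The pair weights are summed over \<open>y\<close>: \<open>b2\<close> gives
  \<open>b1 i x\<close>, the middle term vanishes because the next belief vector annihilates
  \<open>V_mat\<close> from the left, and the last term is a diagonal entry of
  \<open>B V = U\<close>.\<close>

lemma single_weight_sum:
  assumes b: "bp_beliefs n b1 b2" and n: "n \<ge> 2" and i: "i \<in> {1..n}"
  shows "(\<Sum>s\<in>configs n. if s i = x then ring_weight n b1 b2 s else 0) =
    b1 i x + U_mat n b1 b2 i $ x $ x"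
proof -
  let ?B = "B_mat n b1 b2" and ?V = "V_mat n b1 b2 i"
  have "b_vec b1 (ring_succ n i) v* ?V = 0"
    using transition_split_V_mat[OF b n i] by (simp add: transition_split_def)
  then have "(b_vec b1 (ring_succ n i) v* ?V) $ x = 0"
    by simp
  then have bV: "(\<Sum>y\<in>UNIV. ?V $ y $ x * b1 (ring_succ n i) y) = 0"
    by (simp add: vector_matrix_mult_def b_vec_def mult.commute)
  have "U_mat n b1 b2 i = ?B i ** ?V"
    using i by (simp add: U_mat_def V_mat_def mat_prod_rec matrix_mul_assoc)
  then have BV: "(\<Sum>y\<in>UNIV. ?B i $ x $ y * ?V $ y $ x) = U_mat n b1 b2 i $ x $ x"
    by (simp add: matrix_matrix_mult_def)
  have "(if s i = x then w else 0) =
      (\<Sum>y\<in>UNIV. if s i = x \<and> s (ring_succ n i) = y then w else 0)" for s and w :: real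
    by simp
  then have "(\<Sum>s\<in>configs n. if s i = x then ring_weight n b1 b2 s else 0) =
      (\<Sum>y\<in>UNIV. \<Sum>s\<in>configs n.
        if s i = x \<and> s (ring_succ n i) = y then ring_weight n b1 b2 s else 0)"
    by (simp only: sum.swap[of _ "configs n"])
  then show ?thesis
    by (simp add: pair_weight_sum[OF b n i] sum.distrib bV BV bp_beliefsD(3)[OF b i])
qed

section \<open>From weights to probabilities\<close>

lemma pmf_map_eq_sum:
  assumes "finite S" "set_pmf p \<subseteq> S"
  shows "pmf (map_pmf g p) z = (\<Sum>s\<in>S. if g s = z then pmf p s else 0)"
proof -
  \<comment> \<open>Points outside \<open>S\<close> have probability 0, so the preimage may be cut
    down to a finite set.\<close>
  have "pmf (map_pmf g p) z = measure (measure_pmf p) (g -` {z} \<inter> S)"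
    unfolding pmf_map using assms(2)
    by (intro measure_pmf.finite_measure_eq_AE) (auto simp: AE_measure_pmf_iff)
  also have "\<dots> = (\<Sum>s\<in>g -` {z} \<inter> S. pmf p s)"
    using assms(1) by (simp add: measure_measure_pmf_finite)
  also have "\<dots> = (\<Sum>s\<in>S. if g s = z then pmf p s else 0)"
    using assms(1) by (intro sum.mono_neutral_cong_left) auto
  finally show ?thesis .
qed

theorem proposition5p1:
  fixes n :: nat
    and b1 :: "nat \<Rightarrow> 'q::finite \<Rightarrow> real"
    and b2 :: "nat \<Rightarrow> 'q \<Rightarrow> 'q \<Rightarrow> real"
    and p :: "(nat \<Rightarrow> 'q) pmf"
  assumes "n \<ge> 3"
    and "bp_beliefs n b1 b2"
    and "set_pmf p \<subseteq> configs n"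
    and "\<And>s. s \<in> configs n \<Longrightarrow> pmf p s = 1 / Z_BP n b1 b2 * ring_weight n b1 b2 s"
  shows "Z_BP n b1 b2 = 1 + trace (U_tot n b1 b2) \<and>
    (\<forall>i\<in>{1..n}. \<forall>x.
       pmf (map_pmf (\<lambda>s. s i) p) x = (b1 i x + U_mat n b1 b2 i $ x $ x) / Z_BP n b1 b2) \<and>
    (\<forall>i\<in>{1..n}. \<forall>x y.
       pmf (map_pmf (\<lambda>s. (s i, s (ring_succ n i))) p) (x, y) =
         (b2 i x y + V_mat n b1 b2 i $ y $ x * b1 (ring_succ n i) y
            + B_mat n b1 b2 i $ x $ y * V_mat n b1 b2 i $ y $ x) / Z_BP n b1 b2)"
proof (intro conjI ballI allI)
  note b = assms(2)
  have n: "n \<ge> 2"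
    using assms(1) by simp
  \<comment> \<open>The codomain of \<open>g\<close> is left open so that this serves both sites and
    edges.\<close>
  have marginal: "pmf (map_pmf g p) z =
      (\<Sum>s\<in>configs n. if g s = z then ring_weight n b1 b2 s else 0) / Z_BP n b1 b2"
    for g :: "(nat \<Rightarrow> 'q) \<Rightarrow> 'c" and z
  proof -
    have "finite (configs n :: (nat \<Rightarrow> 'q) set)"
      by (simp add: configs_def finite_PiE)
    then show ?thesis
      using assms(3,4)
      by (auto simp: pmf_map_eq_sum sum_divide_distrib intro!: sum.cong)
  qed
  show "Z_BP n b1 b2 = 1 + trace (U_tot n b1 b2)"
    using Z_BP_eq[OF b] n by simp
  show "pmf (map_pmf (\<lambda>s. s i) p) x = (b1 i x + U_mat n b1 b2 i $ x $ x) / Z_BP n b1 b2"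
    if "i \<in> {1..n}" for i x
    unfolding marginal single_weight_sum[OF b n that] ..
  show "pmf (map_pmf (\<lambda>s. (s i, s (ring_succ n i))) p) (x, y) =
         (b2 i x y + V_mat n b1 b2 i $ y $ x * b1 (ring_succ n i) y
            + B_mat n b1 b2 i $ x $ y * V_mat n b1 b2 i $ y $ x) / Z_BP n b1 b2"
    if "i \<in> {1..n}" for i x y
    unfolding marginal prod.inject pair_weight_sum[OF b n that] ..
qed

end
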